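(* There are no integers $x,y,z$ with $\gcd(x,y)=1$ satisfying $7x^2+y^6=4z^3$. *)

theory Defs
  imports Main
begin

end

theory Submission
  imports Defs "HOL-Number_Theory.Cong"
begin

text \<open>
  Reading the equation as 7 x^2 + a^3 = 4 z^3 with a = y^2, one sees modulo 7 that 7 divides both
  a and z, for otherwise 4 would be a cube modulo 7. Then 7^3 divides 7 x^2, so 7 divides x as well
  as y.
\<close>

lemma prime_dvd_if_cong_nonresidue_mult_power:
  fixes p a b c :: int
  assumes "prime p"
    and nonresidue: "\<nexists>t. [t ^ n = c] (mod p)"
    and cong: "[a ^ n = c * b ^ n] (mod p)"
  shows "p dvd a" and "p dvd b"
proof -
  show "p dvd b"
  proof (rule ccontr)
    assume "\<not> p dvd b"
    with \<open>prime p\<close> have "coprime b p"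
      by (metis prime_imp_coprime coprime_commute)
    then obtain b' where inverse: "[b * b' = 1] (mod p)"
      using cong_solve_coprime_int by blast
    have "[(a * b') ^ n = c * b ^ n * b' ^ n] (mod p)"
      unfolding power_mult_distrib using cong by (rule cong_scalar_right)
    also have "c * b ^ n * b' ^ n = c * (b * b') ^ n"
      by (simp add: power_mult_distrib)
    also have "[c * (b * b') ^ n = c * 1 ^ n] (mod p)"
      using inverse by (intro cong_scalar_left cong_pow)
    finally show False
      using nonresidue by auto
  qed
  have "n > 0"
    using nonresidue cong by (cases n) auto
  with \<open>prime p\<close> \<open>p dvd b\<close> have "p dvd c * b ^ n"
    by (simp add: prime_dvd_power_iff)
  with cong have "p dvd a ^ n"
    by (simp add: cong_dvd_iff)
  with \<open>prime p\<close> show "p dvd a"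
    by (rule prime_dvd_power)
qed

lemma prime_dvd_if_prime_mult_power_add_power_eq:
  fixes p a b c x :: int
  assumes "prime p" and "n \<ge> 2"
    and nonresidue: "\<nexists>t. [t ^ n = c] (mod p)"
    and eq: "p * x ^ k + a ^ n = c * b ^ n"
  shows "p dvd a" and "p dvd x"
proof -
  have "[a ^ n = c * b ^ n] (mod p)"
    by (simp add: cong_iff_dvd_diff flip: eq)
  note dvd = prime_dvd_if_cong_nonresidue_mult_power[OF \<open>prime p\<close> nonresidue this]
  show "p dvd a"
    by (fact dvd(1))
  have "p ^ 2 dvd a ^ n" and "p ^ 2 dvd b ^ n"
    using dvd \<open>n \<ge> 2\<close> by (simp_all add: dvd_power_le)
  then have "p ^ 2 dvd c * b ^ n - a ^ n"
    by simp
  also have "c * b ^ n - a ^ n = p * x ^ k"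
    by (simp flip: eq)
  finally have "p dvd x ^ k"
    using \<open>prime p\<close> by (simp add: power2_eq_square)
  with \<open>prime p\<close> show "p dvd x"
    by (rule prime_dvd_power)
qed

lemma four_not_cube_mod_7: "\<nexists>t :: int. [t ^ 3 = 4] (mod 7)"
proof
  assume "\<exists>t :: int. [t ^ 3 = 4] (mod 7)"
  then obtain t :: int where "(t mod 7) ^ 3 mod 7 = 4"
    by (auto simp: cong_def power_mod)
  moreover have "t mod 7 \<in> {0, 1, 2, 3, 4, 5, 6}"
    by (simp, presburger)
  ultimately show False
    by auto
qed

theorem theorem6:
  shows "\<not> (\<exists>x y z :: int. gcd x y = 1 \<and> 7 * x ^ 2 + y ^ 6 = 4 * z ^ 3)"
proof
  assume "\<exists>x y z :: int. gcd x y = 1 \<and> 7 * x ^ 2 + y ^ 6 = 4 * z ^ 3"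
  then obtain x y z :: int
    where coprime: "gcd x y = 1" and eq: "7 * x ^ 2 + y ^ 6 = 4 * z ^ 3"
    by (elim exE conjE)
  have prime_7: "prime (7 :: int)"
    by simp
  have "7 * x ^ 2 + (y ^ 2) ^ 3 = 4 * z ^ 3"
    using eq by simp
  note dvd = prime_dvd_if_prime_mult_power_add_power_eq[OF prime_7 _ four_not_cube_mod_7 this]
  have "7 dvd y ^ 2"
    using dvd(1) by simp
  with prime_7 have "7 dvd y"
    by (rule prime_dvd_power)
  moreover have "7 dvd x"
    using dvd(2) by simp
  ultimately have "7 dvd gcd x y"
    by simp
  with coprime show False
    by simp
qed

end
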